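(* Let $L$ be a finite-dimensional Lie algebra over a field $F$. 1. $L$ is primitive of type 1 if and only if $L$ is monolithic with abelian monolith $W$ and $\phi(L) = 0$. 2. If $F$ has characteristic zero, then $L$ is primitive of type 1 if and only if $L = W \ltimes (C \oplus S)$, where $W$ is the abelian monolith of $L$ (an ideal of $L$), $C$ is an abelian subalgebra of $L$ every element of which acts semisimply on $W$, and $S$ is a Levi subalgebra of $L$. 3. If $L$ is solvable, then $L$ is primitive if and only if it has a self-centralising minimal ideal.
   Context: The core $U_L$ of a subalgebra $U$ is the largest ideal of $L$ contained in $U$; $U$ is core-free if $U_L=0$. $L$ is primitive if it has a core-free maximal subalgebra. A primitive Lie algebra is of type 1 if it has a unique minimal ideal and that ideal is abelian. $L$ is monolithic if it has a unique minimal ideal (its monolith). The Frattini ideal $\phi(L)$ is the largest ideal of $L$ contained in the intersection of all maximal subalgebras of $L$. An ideal $A$ is self-centralising if $C_L(A) = \{x\in L : [x,A]=0\} = A$. *)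

theory Defs
  imports Complex_Main
begin

text \<open>A Lie algebra L over a field 'k is modelled as the whole type 'v, with scalar
multiplication scale and Lie bracket br. Subalgebras/ideals are subsets of 'v.\<close>

definition lie_algebra :: "('k::field \<Rightarrow> 'v::ab_group_add \<Rightarrow> 'v) \<Rightarrow> ('v \<Rightarrow> 'v \<Rightarrow> 'v) \<Rightarrow> bool" where
  "lie_algebra scale br \<longleftrightarrow> vector_space scale \<and>
     (\<forall>x y z. br (x + y) z = br x z + br y z) \<and>
     (\<forall>x y z. br x (y + z) = br x y + br x z) \<and>
     (\<forall>a x y. br (scale a x) y = scale a (br x y)) \<and>
     (\<forall>a x y. br x (scale a y) = scale a (br x y)) \<and>
     (\<forall>x. br x x = 0) \<and>
     (\<forall>x y z. br x (br y z) + br y (br z x) + br z (br x y) = 0)"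

definition fin_dim :: "('k::field \<Rightarrow> 'v::ab_group_add \<Rightarrow> 'v) \<Rightarrow> bool" where
  "fin_dim scale \<longleftrightarrow> (\<exists>B. finite B \<and> module.span scale B = UNIV)"

definition lie_subalgebra :: "('k::field \<Rightarrow> 'v::ab_group_add \<Rightarrow> 'v) \<Rightarrow> ('v \<Rightarrow> 'v \<Rightarrow> 'v) \<Rightarrow> 'v set \<Rightarrow> bool" where
  "lie_subalgebra scale br U \<longleftrightarrow> module.subspace scale U \<and> (\<forall>x\<in>U. \<forall>y\<in>U. br x y \<in> U)"

definition lie_ideal :: "('k::field \<Rightarrow> 'v::ab_group_add \<Rightarrow> 'v) \<Rightarrow> ('v \<Rightarrow> 'v \<Rightarrow> 'v) \<Rightarrow> 'v set \<Rightarrow> bool" where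
  "lie_ideal scale br I \<longleftrightarrow> module.subspace scale I \<and> (\<forall>x. \<forall>y\<in>I. br x y \<in> I)"

definition core :: "('k::field \<Rightarrow> 'v::ab_group_add \<Rightarrow> 'v) \<Rightarrow> ('v \<Rightarrow> 'v \<Rightarrow> 'v) \<Rightarrow> 'v set \<Rightarrow> 'v set" where
  "core scale br U = module.span scale (\<Union>{I. lie_ideal scale br I \<and> I \<subseteq> U})"

definition core_free :: "('k::field \<Rightarrow> 'v::ab_group_add \<Rightarrow> 'v) \<Rightarrow> ('v \<Rightarrow> 'v \<Rightarrow> 'v) \<Rightarrow> 'v set \<Rightarrow> bool" where
  "core_free scale br U \<longleftrightarrow> core scale br U = {0}"

definition maximal_subalgebra :: "('k::field \<Rightarrow> 'v::ab_group_add \<Rightarrow> 'v) \<Rightarrow> ('v \<Rightarrow> 'v \<Rightarrow> 'v) \<Rightarrow> 'v set \<Rightarrow> bool" where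
  "maximal_subalgebra scale br M \<longleftrightarrow> lie_subalgebra scale br M \<and> M \<noteq> UNIV \<and>
     (\<forall>N. lie_subalgebra scale br N \<and> M \<subseteq> N \<longrightarrow> N = M \<or> N = UNIV)"

definition primitive :: "('k::field \<Rightarrow> 'v::ab_group_add \<Rightarrow> 'v) \<Rightarrow> ('v \<Rightarrow> 'v \<Rightarrow> 'v) \<Rightarrow> bool" where
  "primitive scale br \<longleftrightarrow> (\<exists>M. maximal_subalgebra scale br M \<and> core_free scale br M)"

definition minimal_ideal :: "('k::field \<Rightarrow> 'v::ab_group_add \<Rightarrow> 'v) \<Rightarrow> ('v \<Rightarrow> 'v \<Rightarrow> 'v) \<Rightarrow> 'v set \<Rightarrow> bool" where
  "minimal_ideal scale br A \<longleftrightarrow> lie_ideal scale br A \<and> A \<noteq> {0} \<and>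
     (\<forall>B. lie_ideal scale br B \<and> B \<subseteq> A \<longrightarrow> B = {0} \<or> B = A)"

definition abelian :: "('v::ab_group_add \<Rightarrow> 'v \<Rightarrow> 'v) \<Rightarrow> 'v set \<Rightarrow> bool" where
  "abelian br A \<longleftrightarrow> (\<forall>x\<in>A. \<forall>y\<in>A. br x y = 0)"

definition monolith :: "('k::field \<Rightarrow> 'v::ab_group_add \<Rightarrow> 'v) \<Rightarrow> ('v \<Rightarrow> 'v \<Rightarrow> 'v) \<Rightarrow> 'v set \<Rightarrow> bool" where
  "monolith scale br W \<longleftrightarrow> minimal_ideal scale br W \<and> (\<forall>A. minimal_ideal scale br A \<longrightarrow> A = W)"

definition monolithic :: "('k::field \<Rightarrow> 'v::ab_group_add \<Rightarrow> 'v) \<Rightarrow> ('v \<Rightarrow> 'v \<Rightarrow> 'v) \<Rightarrow> bool" where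
  "monolithic scale br \<longleftrightarrow> (\<exists>W. monolith scale br W)"

definition primitive_type1 :: "('k::field \<Rightarrow> 'v::ab_group_add \<Rightarrow> 'v) \<Rightarrow> ('v \<Rightarrow> 'v \<Rightarrow> 'v) \<Rightarrow> bool" where
  "primitive_type1 scale br \<longleftrightarrow> primitive scale br \<and>
     (\<exists>A. monolith scale br A \<and> abelian br A)"

definition frattini :: "('k::field \<Rightarrow> 'v::ab_group_add \<Rightarrow> 'v) \<Rightarrow> ('v \<Rightarrow> 'v \<Rightarrow> 'v) \<Rightarrow> 'v set" where
  "frattini scale br = core scale br (\<Inter>{M. maximal_subalgebra scale br M})"

definition centraliser :: "('v::ab_group_add \<Rightarrow> 'v \<Rightarrow> 'v) \<Rightarrow> 'v set \<Rightarrow> 'v set" where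
  "centraliser br A = {x. \<forall>a\<in>A. br x a = 0}"

primrec derived :: "('k::field \<Rightarrow> 'v::ab_group_add \<Rightarrow> 'v) \<Rightarrow> ('v \<Rightarrow> 'v \<Rightarrow> 'v) \<Rightarrow> nat \<Rightarrow> 'v set \<Rightarrow> 'v set" where
  "derived scale br 0 A = A"
| "derived scale br (Suc n) A =
     module.span scale {br x y | x y. x \<in> derived scale br n A \<and> y \<in> derived scale br n A}"

definition solvable_set :: "('k::field \<Rightarrow> 'v::ab_group_add \<Rightarrow> 'v) \<Rightarrow> ('v \<Rightarrow> 'v \<Rightarrow> 'v) \<Rightarrow> 'v set \<Rightarrow> bool" where
  "solvable_set scale br A \<longleftrightarrow> (\<exists>n. derived scale br n A = {0})"

definition solvable_lie :: "('k::field \<Rightarrow> 'v::ab_group_add \<Rightarrow> 'v) \<Rightarrow> ('v \<Rightarrow> 'v \<Rightarrow> 'v) \<Rightarrow> bool" where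
  "solvable_lie scale br \<longleftrightarrow> solvable_set scale br UNIV"

definition radical :: "('k::field \<Rightarrow> 'v::ab_group_add \<Rightarrow> 'v) \<Rightarrow> ('v \<Rightarrow> 'v \<Rightarrow> 'v) \<Rightarrow> 'v set" where
  "radical scale br = module.span scale (\<Union>{I. lie_ideal scale br I \<and> solvable_set scale br I})"

definition semisimple_subalg :: "('k::field \<Rightarrow> 'v::ab_group_add \<Rightarrow> 'v) \<Rightarrow> ('v \<Rightarrow> 'v \<Rightarrow> 'v) \<Rightarrow> 'v set \<Rightarrow> bool" where
  "semisimple_subalg scale br S \<longleftrightarrow> lie_subalgebra scale br S \<and>
     (\<forall>I. module.subspace scale I \<and> I \<subseteq> S \<and> (\<forall>s\<in>S. \<forall>i\<in>I. br s i \<in> I) \<and>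
          solvable_set scale br I \<longrightarrow> I = {0})"

definition levi_subalgebra :: "('k::field \<Rightarrow> 'v::ab_group_add \<Rightarrow> 'v) \<Rightarrow> ('v \<Rightarrow> 'v \<Rightarrow> 'v) \<Rightarrow> 'v set \<Rightarrow> bool" where
  "levi_subalgebra scale br S \<longleftrightarrow> semisimple_subalg scale br S \<and>
     radical scale br \<inter> S = {0} \<and> {r + s | r s. r \<in> radical scale br \<and> s \<in> S} = UNIV"

definition acts_semisimply :: "('k::field \<Rightarrow> 'v::ab_group_add \<Rightarrow> 'v) \<Rightarrow> ('v \<Rightarrow> 'v) \<Rightarrow> 'v set \<Rightarrow> bool" where
  "acts_semisimply scale f W \<longleftrightarrow>
     (\<forall>U. module.subspace scale U \<and> U \<subseteq> W \<and> f ` U \<subseteq> U \<longrightarrow>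
        (\<exists>V. module.subspace scale V \<and> V \<subseteq> W \<and> f ` V \<subseteq> V \<and> U \<inter> V = {0} \<and>
             {u + v | u v. u \<in> U \<and> v \<in> V} = W))"

end

theory Submission
  imports Defs
begin

text \<open>Let \<open>W\<close> be an abelian minimal ideal and \<open>M\<close> a core-free maximal subalgebra. Then \<open>M\<close> is a
  complement of \<open>W\<close> and \<open>W\<close> is self-centralising; conversely every complement of an abelian
  minimal ideal is a maximal subalgebra.

  In characteristic zero neither Levi's theorem nor Cartan's criterion is needed: \<open>M\<close> acts
  faithfully and irreducibly on \<open>W\<close>. If \<open>z\<close> is a sum of brackets \<open>[x, y]\<close> with all \<open>y\<close> commuting
  with \<open>z\<close> on \<open>W\<close>, and \<open>z\<close> is invertible on \<open>W\<close> with inverse \<open>u\<close>, then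
  \<open>dim W = tr (z u) = \<Sum> tr [x, y u] = 0\<close>, which is absurd. Hence solvable ideals of \<open>M\<close> are
  central and \<open>[M, M] \<inter> Z(M) = 0\<close>. Any vector space complement \<open>S \<supseteq> [M, M]\<close> of \<open>C = Z(M)\<close> in \<open>M\<close>
  is then an ideal of \<open>M\<close> and a Levi subalgebra.

  In the solvable case, an ideal that is abelian modulo a self-centralising minimal ideal \<open>A\<close>
  contains an element acting invertibly on \<open>A\<close>, whose Fitting null component complements \<open>A\<close>.\<close>

text \<open>Fixing a \<open>Basis\<close> gives access to dimension theory; one is obtained from
  \<open>fin_dim\<close> at the end.\<close>

locale fd_lie_algebra = finite_dimensional_vector_space scale Basis
  for scale :: "'k::field \<Rightarrow> 'v::ab_group_add \<Rightarrow> 'v" (infixr \<open>*s\<close> 75) and Basis +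
  fixes br :: "'v \<Rightarrow> 'v \<Rightarrow> 'v"
  assumes lie: "lie_algebra scale br"
begin

abbreviation ideal where "ideal \<equiv> lie_ideal scale br"
abbreviation subalgebra where "subalgebra \<equiv> lie_subalgebra scale br"
abbreviation ssum :: "'v set \<Rightarrow> 'v set \<Rightarrow> 'v set" where
  "ssum A B \<equiv> {a + b | a b. a \<in> A \<and> b \<in> B}"
abbreviation brackets :: "'v set \<Rightarrow> 'v set \<Rightarrow> 'v set" where
  "brackets A B \<equiv> span {br x y | x y. x \<in> A \<and> y \<in> B}"

subsection \<open>Subspaces\<close>

text \<open>A nonzero member of least dimension works. The family is later that of ideals, of
  subspaces stable under an ideal, or of subspaces stable under one operator.\<close>

lemma exists_minimal_subspace:
  assumes P: "P V" "V \<noteq> {0}" and sub: "\<And>T. P T \<Longrightarrow> subspace T"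
  obtains U where "P U" "U \<noteq> {0}" "U \<subseteq> V" "\<And>T. P T \<Longrightarrow> T \<subseteq> U \<Longrightarrow> T = {0} \<or> T = U"
proof -
  obtain U where U: "P U \<and> U \<noteq> {0} \<and> U \<subseteq> V"
    and le: "\<And>T. P T \<and> T \<noteq> {0} \<and> T \<subseteq> V \<Longrightarrow> dim U \<le> dim T"
    using ex_has_least_nat[of "\<lambda>U. P U \<and> U \<noteq> {0} \<and> U \<subseteq> V" V dim] P by blast
  have "T = {0} \<or> T = U" if "P T" "T \<subseteq> U" for T
    using subspace_dim_equal[of T U] sub le[of T] U that by blast
  with U that show thesis by blast
qed

lemma exists_maximal_subspace:
  assumes P: "P V" and sub: "\<And>T. P T \<Longrightarrow> subspace T"
  obtains U where "P U" "V \<subseteq> U" "\<And>T. P T \<Longrightarrow> U \<subseteq> T \<Longrightarrow> T = U"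
proof -
  \<comment> \<open>Bounded dimensions give a member of greatest dimension; the bound is strict,
    hence \<open>Suc\<close>.\<close>
  have "\<forall>T. P T \<and> V \<subseteq> T \<longrightarrow> dim T < Suc dimension"
    using dim_subset_UNIV by (simp add: less_Suc_eq_le)
  then obtain U where U: "P U \<and> V \<subseteq> U"
    and ge: "\<And>T. P T \<and> V \<subseteq> T \<Longrightarrow> dim T \<le> dim U"
    using ex_has_greatest_nat[of "\<lambda>U. P U \<and> V \<subseteq> U" V dim] P by (metis order_refl)
  have "T = U" if "P T" "U \<subseteq> T" for T
    using subspace_dim_equal[of U T] sub ge[of T] U that by blast
  with U that show thesis by blast
qed

lemma ssum_left: "subspace B \<Longrightarrow> A \<subseteq> ssum A B"
  using subspace_0 by force

lemma ssum_right: "subspace A \<Longrightarrow> B \<subseteq> ssum A B"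
  using subspace_0 by force

lemma ssum_least: "subspace C \<Longrightarrow> A \<subseteq> C \<Longrightarrow> B \<subseteq> C \<Longrightarrow> ssum A B \<subseteq> C"
  using subspace_add by blast

text \<open>Take \<open>E\<close> maximal among members that contain \<open>D\<close> and meet
  \<open>U\<close> trivially. If \<open>U + E\<close> is proper, the \<open>Q\<close> supplied for
  it can be added to \<open>E\<close>. This serves for plain subspaces and for
  \<open>c\<close>-stable ones.\<close>

lemma exists_complement_extending:
  assumes sub: "\<And>T. P T \<Longrightarrow> subspace T"
    and sum: "\<And>S T. P S \<Longrightarrow> P T \<Longrightarrow> P (ssum S T)"
    and Q: "\<And>T. P T \<Longrightarrow> T \<subseteq> V \<Longrightarrow> T \<noteq> V \<Longrightarrow> \<exists>Q. P Q \<and> Q \<subseteq> V \<and> Q \<inter> T = {0} \<and> Q \<noteq> {0}"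
    and V: "P V" and U: "P U" "U \<subseteq> V" and D: "P D" "D \<subseteq> V" "U \<inter> D = {0}"
  obtains E where "P E" "D \<subseteq> E" "E \<subseteq> V" "U \<inter> E = {0}" "ssum U E = V"
proof -
  obtain E where E: "P E \<and> E \<subseteq> V \<and> U \<inter> E = {0}" "D \<subseteq> E"
    and max: "\<And>T. P T \<and> T \<subseteq> V \<and> U \<inter> T = {0} \<Longrightarrow> E \<subseteq> T \<Longrightarrow> T = E"
    using exists_maximal_subspace[of "\<lambda>E. P E \<and> E \<subseteq> V \<and> U \<inter> E = {0}" D] sub D by blast
  have sE: "subspace E" and sU: "subspace U" and sV: "subspace V" using E sub U V by auto
  have "ssum U E = V"
  proof (rule ccontr)
    assume ne: "ssum U E \<noteq> V"
    have "P (ssum U E)" "ssum U E \<subseteq> V"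
      using E U sum[of U E] ssum_least[OF sV, of U E] by simp_all
    then obtain Q where Q': "P Q" "Q \<subseteq> V" "Q \<inter> ssum U E = {0}" "Q \<noteq> {0}"
      using Q[OF _ _ ne] by auto
    have sQ: "subspace Q" using sub Q' by auto
    \<comment> \<open>If \<open>e + q\<close> lies in \<open>U\<close>, then \<open>q\<close> lies
      in \<open>Q\<close> and in \<open>U + E\<close>, so \<open>q = 0\<close> and the element lies
      in both \<open>U\<close> and \<open>E\<close>.\<close>
    have "U \<inter> ssum E Q = {0}"
    proof -
      have "x = 0" if x: "x \<in> U" "x = e + q" "e \<in> E" "q \<in> Q" for x e q
      proof -
        have "q = x + (- e)" using x by simp
        moreover have "- e \<in> E" using x sE subspace_neg by blast
        ultimately have "q \<in> Q \<inter> ssum U E" using x by blast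
        then have "x \<in> U \<inter> E" using Q' x by auto
        then show ?thesis using E by auto
      qed
      moreover have "0 \<in> U \<inter> ssum E Q"
        using subspace_0[OF sU] subspace_0[OF sE] subspace_0[OF sQ] by force
      ultimately show ?thesis by blast
    qed
    moreover have "P (ssum E Q)" "ssum E Q \<subseteq> V"
      using E Q' sum[of E Q] ssum_least[OF sV, of E Q] by simp_all
    ultimately have "ssum E Q = E" using max[of "ssum E Q"] ssum_left[OF sQ, of E] by simp
    then have "Q \<subseteq> ssum U E" using ssum_right[OF sE, of Q] ssum_right[OF sU, of E] by simp
    then show False using Q' by blast
  qed
  with that E show thesis by blast
qed

text \<open>A line through a vector outside \<open>T\<close> serves as \<open>Q\<close>. The
  prescribed \<open>D\<close> will be \<open>[M, M]\<close>.\<close>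

lemma exists_subspace_complement_extending:
  assumes V: "subspace V" and U: "subspace U" "U \<subseteq> V" and D: "subspace D" "D \<subseteq> V" "U \<inter> D = {0}"
  obtains E where "subspace E" "D \<subseteq> E" "E \<subseteq> V" "U \<inter> E = {0}" "ssum U E = V"
proof (rule exists_complement_extending[of subspace V U D])
  fix T assume T: "subspace T" "T \<subseteq> V" "T \<noteq> V"
  obtain v where v: "v \<in> V" "v \<notin> T" using T by blast
  have "v \<noteq> 0" using v subspace_0[OF T(1)] by blast
  have "k = 0" if "k *s v \<in> T" for k
  proof (rule ccontr)
    assume "k \<noteq> 0"
    then show False using subspace_scale[OF T(1) that, of "inverse k"] v by simp
  qed
  then have "span {v} \<inter> T = {0}" using subspace_0[OF T(1)] span_zero by (auto simp: span_singleton)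
  moreover have "span {v} \<subseteq> V" using v V by (simp add: span_minimal)
  moreover have "span {v} \<noteq> {0}" using \<open>v \<noteq> 0\<close> span_base[of v "{v}"] by blast
  ultimately show "\<exists>Q. subspace Q \<and> Q \<subseteq> V \<and> Q \<inter> T = {0} \<and> Q \<noteq> {0}"
    using subspace_span by blast
next
  fix E assume "subspace E" "D \<subseteq> E" "E \<subseteq> V" "U \<inter> E = {0}" "ssum U E = V"
  then show thesis by (rule that)
qed (simp_all add: assms subspace_sums)

text \<open>In finite dimension an injective endomorphism of \<open>W\<close> is onto, so a left
  inverse is two-sided on \<open>W\<close>. The inverse \<open>g\<close> lives on the whole space so
  that it composes with brackets.\<close>

lemma linear_inverse_on:
  assumes f: "Vector_Spaces.linear scale scale f" and W: "subspace W" "f ` W \<subseteq> W"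
    and inj: "\<And>w. w \<in> W \<Longrightarrow> f w = 0 \<Longrightarrow> w = 0"
  obtains g where "Vector_Spaces.linear scale scale g" "range g \<subseteq> W"
    "\<And>w. w \<in> W \<Longrightarrow> g (f w) = w" "\<And>w. w \<in> W \<Longrightarrow> f (g w) = w"
proof -
  interpret f: Vector_Spaces.linear scale scale f by fact
  interpret p: finite_dimensional_vector_space_pair scale Basis scale Basis by unfold_locales
  have injW: "inj_on f W" using f.inj_on_iff_eq_0[OF W(1)] inj by blast
  obtain g where g: "range g \<subseteq> W" "Vector_Spaces.linear scale scale g" "\<forall>v\<in>W. g (f v) = v"
    using p.linear_exists_left_inverse_on[OF f W(1) injW] by blast
  have "dim (f ` W) = dim W" 
    using p.dim_image_eq[OF f, of W] injW span_eq_iff[THEN iffD2, OF W(1)] by metis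
  then have "f ` W = W" using subspace_dim_equal[OF f.subspace_image[OF W(1)] W(1) W(2)] by simp
  then have "f (g w) = w" if "w \<in> W" for w using g(3) that by (metis imageE)
  with g that show thesis by blast
qed

subsection \<open>Traces\<close>

text \<open>Operators are functions on the whole space. For linear \<open>f\<close> this is the
  trace of the restriction to \<open>span B\<close>, provided \<open>f\<close> maps \<open>B\<close>
  into the span; \<open>representation\<close> is zero outside it.\<close>

definition trace_on :: "'v set \<Rightarrow> ('v \<Rightarrow> 'v) \<Rightarrow> 'k" where
  "trace_on B f = (\<Sum>b\<in>B. representation B (f b) b)"

context
  fixes B :: "'v set"
  assumes indep: "independent B"
begin

lemma trace_on_cong: "(\<And>w. w \<in> span B \<Longrightarrow> f w = g w) \<Longrightarrow> trace_on B f = trace_on B g"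
  unfolding trace_on_def by (intro sum.cong refl) (simp add: span_base)

text \<open>Expanded in matrix entries, both traces are the same double sum, taken in opposite
  orders.\<close>

lemma trace_on_comm:
  assumes f: "Vector_Spaces.linear scale scale f" "f ` span B \<subseteq> span B"
    and g: "Vector_Spaces.linear scale scale g" "g ` span B \<subseteq> span B"
  shows "trace_on B (\<lambda>x. f (g x)) = trace_on B (\<lambda>x. g (f x))"
proof -
  have fin: "finite B" using indep by (rule finiteI_independent)
  have exp: "representation B (f (g b)) b
      = (\<Sum>c\<in>B. representation B (g b) c * representation B (f c) b)"
    if f: "Vector_Spaces.linear scale scale f" "f ` span B \<subseteq> span B" and g: "g ` span B \<subseteq> span B" and b: "b \<in> B"
    for f g b
  proof -
    interpret f: Vector_Spaces.linear scale scale f by fact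
    have gb: "g b \<in> span B" using b g span_base by blast
    have fc: "f c \<in> span B" if "c \<in> B" for c using that f(2) span_base by blast
    have "f (g b) = f (\<Sum>c\<in>B. representation B (g b) c *s c)"
      using sum_representation_eq[OF indep gb fin] by simp
    also have "\<dots> = (\<Sum>c\<in>B. representation B (g b) c *s f c)"
      by (simp add: f.sum f.scale)
    finally show ?thesis
      using fc by (simp add: representation_sum[OF indep] representation_scale[OF indep] span_scale)
  qed
  show ?thesis unfolding trace_on_def
    using sum.swap[of "\<lambda>b c. representation B (g b) c * representation B (f c) b" B B]
    by (simp add: exp f g mult.commute)
qed

end

lemma trace_on_add:
  "independent B \<Longrightarrow> (\<And>b. b \<in> B \<Longrightarrow> f b \<in> span B) \<Longrightarrow> (\<And>b. b \<in> B \<Longrightarrow> g b \<in> span B) \<Longrightarrow>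
    trace_on B (\<lambda>x. f x + g x) = trace_on B f + trace_on B g"
  unfolding trace_on_def by (simp add: representation_add sum.distrib)

lemma trace_on_diff:
  "independent B \<Longrightarrow> (\<And>b. b \<in> B \<Longrightarrow> f b \<in> span B) \<Longrightarrow> (\<And>b. b \<in> B \<Longrightarrow> g b \<in> span B) \<Longrightarrow>
    trace_on B (\<lambda>x. f x - g x) = trace_on B f - trace_on B g"
  unfolding trace_on_def by (simp add: representation_diff sum_subtractf)

lemma trace_on_scale:
  "independent B \<Longrightarrow> (\<And>b. b \<in> B \<Longrightarrow> f b \<in> span B) \<Longrightarrow>
    trace_on B (\<lambda>x. c *s f x) = c * trace_on B f"
  unfolding trace_on_def by (simp add: representation_scale sum_distrib_left)

lemma trace_on_id: "independent B \<Longrightarrow> trace_on B (\<lambda>x. x) = of_nat (card B)"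
  unfolding trace_on_def by (simp add: representation_basis)

subsection \<open>Brackets, ideals and subalgebras\<close>

lemma br_add_left: "br (x + y) z = br x z + br y z"
  and br_add_right: "br x (y + z) = br x y + br x z"
  and br_scale_left: "br (a *s x) y = a *s br x y"
  and br_scale_right: "br x (a *s y) = a *s br x y"
  and br_self: "br x x = 0"
  and br_jacobi: "br x (br y z) + br y (br z x) + br z (br x y) = 0"
  using lie unfolding lie_algebra_def by auto

lemma linear_br: "Vector_Spaces.linear scale scale (br x)"
  by unfold_locales (auto simp: br_add_right br_scale_right scale_right_distrib scale_left_distrib)

lemma linear_br_left: "Vector_Spaces.linear scale scale (\<lambda>x. br x y)"
  by unfold_locales (auto simp: br_add_left br_scale_left)

lemma br_zero_right [simp]: "br x 0 = 0" using br_add_right[of x 0 0] by simp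
lemma br_zero_left [simp]: "br 0 x = 0" using br_add_left[of 0 0 x] by simp
lemma br_minus_right: "br x (- y) = - br x y"
  using br_add_right[of x y "- y"] by (simp add: add_eq_0_iff)
lemma br_diff_right: "br x (y - z) = br x y - br x z"
  using br_add_right[of x y "- z"] by (simp add: br_minus_right)

lemma br_anti: "br x y = - br y x"
proof -
  have "br x y + br y x = br (x + y) (x + y)"
    by (simp add: br_add_left br_add_right br_self[of x] br_self[of y])
  then have "br x y + br y x = 0" by (simp only: br_self)
  then show ?thesis by (simp add: add_eq_0_iff2)
qed

text \<open>The Jacobi identity in derivation form, by which operators are moved past one
  another.\<close>

lemma br_leibniz: "br x (br y z) = br (br x y) z + br y (br x z)"
  using br_jacobi[of x y z] br_anti[of z x] br_anti[of z "br x y"]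
  by (simp add: br_minus_right algebra_simps)

text \<open>Lets inclusions of the form "a bracket maps this span into \<open>T\<close>" be checked
  on generators.\<close>

lemma subspace_br_preimage: "subspace T \<Longrightarrow> subspace {x. br y x \<in> T}"
  using Vector_Spaces.linear.axioms(3)[OF linear_br] module_hom.subspace_linear_preimage by blast

lemma subspace_br_left_preimage: "subspace T \<Longrightarrow> subspace {x. br x y \<in> T}"
  using Vector_Spaces.linear.axioms(3)[OF linear_br_left] module_hom.subspace_linear_preimage by blast

lemma idealI: "subspace I \<Longrightarrow> (\<And>x y. y \<in> I \<Longrightarrow> br x y \<in> I) \<Longrightarrow> ideal I"
  unfolding lie_ideal_def by blast

lemma ideal_subspace: "ideal I \<Longrightarrow> subspace I"
  unfolding lie_ideal_def by blast

lemma ideal_left: "ideal I \<Longrightarrow> y \<in> I \<Longrightarrow> br x y \<in> I"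
  unfolding lie_ideal_def by blast

lemma ideal_right: "ideal I \<Longrightarrow> x \<in> I \<Longrightarrow> br x y \<in> I"
  using br_anti[of x y] ideal_left ideal_subspace subspace_neg by metis

lemma ideal_UNIV: "ideal UNIV"
  by (auto intro: idealI)

lemma ideal_brackets:
  assumes "ideal I" "ideal J"
  shows "ideal (brackets I J)"
proof (rule idealI)
  fix x y assume y: "y \<in> brackets I J"
  have "br a b \<in> {y. br x y \<in> brackets I J}" if "a \<in> I" "b \<in> J" for a b
  proof -
    have "br (br x a) b \<in> brackets I J" "br a (br x b) \<in> brackets I J"
      using that ideal_left assms by (blast intro: span_base)+
    then show ?thesis by (simp add: br_leibniz[of x a b] span_add)
  qed
  then have "brackets I J \<subseteq> {y. br x y \<in> brackets I J}"
    by (intro span_minimal subspace_br_preimage) auto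
  with y show "br x y \<in> brackets I J" by blast
qed simp

lemma brackets_least:
  "subspace T \<Longrightarrow> (\<And>x y. x \<in> A \<Longrightarrow> y \<in> B \<Longrightarrow> br x y \<in> T) \<Longrightarrow> brackets A B \<subseteq> T"
  by (rule span_minimal) auto

lemma br_in_brackets: "x \<in> A \<Longrightarrow> y \<in> B \<Longrightarrow> br x y \<in> brackets A B"
  by (rule span_base) blast

lemma ideal_derived: "ideal I \<Longrightarrow> ideal (derived scale br n I)"
  by (induction n) (auto intro: ideal_brackets)

text \<open>By Leibniz \<open>[[x, c], a] = [x, [c, a]] - [c, [x, a]]\<close>, and \<open>c\<close>
  kills both \<open>a\<close> and \<open>[x, a]\<close>.\<close>

lemma ideal_centraliser:
  assumes "ideal A"
  shows "ideal (centraliser br A)"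
proof (rule idealI)
  show "subspace (centraliser br A)"
    unfolding subspace_def centraliser_def by (auto simp: br_add_left br_scale_left)
next
  fix x c assume c: "c \<in> centraliser br A"
  have "br (br x c) a = 0" if "a \<in> A" for a
    using br_leibniz[of x c a] c that ideal_left[OF assms that, of x]
    by (simp add: centraliser_def)
  then show "br x c \<in> centraliser br A" by (simp add: centraliser_def)
qed

lemma subalgebraI:
  "subspace U \<Longrightarrow> (\<And>x y. x \<in> U \<Longrightarrow> y \<in> U \<Longrightarrow> br x y \<in> U) \<Longrightarrow> subalgebra U"
  unfolding lie_subalgebra_def by blast

lemma subalgebra_subspace: "subalgebra U \<Longrightarrow> subspace U"
  unfolding lie_subalgebra_def by blast

lemma subalgebra_br: "subalgebra U \<Longrightarrow> x \<in> U \<Longrightarrow> y \<in> U \<Longrightarrow> br x y \<in> U"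
  unfolding lie_subalgebra_def by blast

lemma subalgebra_ideal_sum:
  assumes A: "ideal A" and M: "subalgebra M"
  shows "subalgebra (ssum A M)"
proof (rule subalgebraI)
  fix x y assume "x \<in> ssum A M" "y \<in> ssum A M"
  then obtain a m b n where *: "x = a + m" "y = b + n" "a \<in> A" "m \<in> M" "b \<in> A" "n \<in> M" by blast
  have "br x y = (br a (b + n) + br m b) + br m n"
    unfolding * by (simp add: br_add_left br_add_right)
  moreover have "br a (b + n) + br m b \<in> A" "br m n \<in> M"
    using * ideal_left[OF A] ideal_right[OF A] subspace_add[OF ideal_subspace[OF A]]
      subalgebra_br[OF M] by auto
  ultimately show "br x y \<in> ssum A M" by blast
qed (simp add: subspace_sums A M ideal_subspace subalgebra_subspace)

subsection \<open>Minimal ideals, cores and maximal subalgebras\<close>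

lemma minimal_idealD:
  assumes "minimal_ideal scale br A"
  shows "ideal A" "A \<noteq> {0}" "subspace A" "\<And>B. ideal B \<Longrightarrow> B \<subseteq> A \<Longrightarrow> B = {0} \<or> B = A"
  using assms ideal_subspace unfolding minimal_ideal_def by auto

lemma exists_minimal_ideal:
  assumes "ideal I" "I \<noteq> {0}"
  obtains A where "minimal_ideal scale br A" "A \<subseteq> I"
proof (rule exists_minimal_subspace[of ideal I])
  fix U assume "ideal U" "U \<noteq> {0}" "U \<subseteq> I" "\<And>T. ideal T \<Longrightarrow> T \<subseteq> U \<Longrightarrow> T = {0} \<or> T = U"
  then show thesis using that[of U] unfolding minimal_ideal_def by simp
qed (use assms ideal_subspace in simp_all)

text \<open>By finite dimension \<open>I\<close> contains some minimal ideal, and this can only be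
  \<open>W\<close>.\<close>

lemma monolith_subset:
  assumes "monolith scale br W" "ideal I" "I \<noteq> {0}"
  shows "W \<subseteq> I"
  using exists_minimal_ideal[OF assms(2,3)] assms(1) unfolding monolith_def by metis

text \<open>Cores enter below only through their vanishing, which becomes a condition on single
  ideals.\<close>

lemma core_eq_0_iff: "core scale br U = {0} \<longleftrightarrow> (\<forall>I. ideal I \<and> I \<subseteq> U \<longrightarrow> I = {0})"
proof
  assume c: "core scale br U = {0}"
  have "I \<subseteq> core scale br U" if "ideal I" "I \<subseteq> U" for I
    unfolding core_def using that by (auto intro: span_base)
  then show "\<forall>I. ideal I \<and> I \<subseteq> U \<longrightarrow> I = {0}"
    unfolding c using ideal_subspace subspace_0 by blast
next
  assume "\<forall>I. ideal I \<and> I \<subseteq> U \<longrightarrow> I = {0}"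
  then have "\<Union>{I. ideal I \<and> I \<subseteq> U} \<subseteq> {0}" by blast
  then have "core scale br U \<subseteq> {0}" unfolding core_def by (rule span_minimal) simp
  moreover have "0 \<in> core scale br U" unfolding core_def by (rule span_zero)
  ultimately show "core scale br U = {0}" by blast
qed

section \<open>Complements of an abelian minimal ideal, and the Frattini criterion\<close>

lemma maximal_subalgebra_sum_eq_UNIV:
  assumes M: "maximal_subalgebra scale br M" and A: "ideal A" "\<not> A \<subseteq> M"
  shows "ssum A M = UNIV"
proof -
  have sM: "subalgebra M" using M unfolding maximal_subalgebra_def by blast
  have "ssum A M = M \<or> ssum A M = UNIV"
    using M subalgebra_ideal_sum[OF A(1) sM] ssum_right[OF ideal_subspace[OF A(1)], of M]
    unfolding maximal_subalgebra_def by simp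
  moreover have "ssum A M \<noteq> M"
    using A(2) ssum_left[OF subalgebra_subspace[OF sM], of A] by metis
  ultimately show ?thesis by simp
qed

text \<open>\<open>A\<close> kills itself, so an element of \<open>A + M\<close> acts on
  \<open>A \<inter> M\<close> through its component in \<open>M\<close>.\<close>

lemma ideal_abelian_inter:
  assumes A: "ideal A" "abelian br A" and M: "subalgebra M" and AM: "ssum A M = UNIV"
  shows "ideal (A \<inter> M)"
proof (rule idealI)
  fix x y assume y: "y \<in> A \<inter> M"
  obtain a m where x: "x = a + m" "a \<in> A" "m \<in> M" using AM by blast
  have "br x y = br m y" using A(2) x y by (simp add: abelian_def br_add_left)
  then show "br x y \<in> A \<inter> M" using y x ideal_left[OF A(1)] subalgebra_br[OF M] by auto
qed (simp add: subspace_inter A M ideal_subspace subalgebra_subspace)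

text \<open>For \<open>N\<close> above \<open>M\<close> the ideal \<open>A \<inter> N\<close> is
  zero or \<open>A\<close>. The modular law gives \<open>N = M\<close> in the first case; in the
  second \<open>N\<close> contains \<open>A + M\<close>.\<close>

lemma complement_maximal_subalgebra:
  assumes A: "minimal_ideal scale br A" "abelian br A"
    and M: "subalgebra M" and AM: "ssum A M = UNIV" "A \<inter> M = {0}"
  shows "maximal_subalgebra scale br M"
  unfolding maximal_subalgebra_def
proof (intro conjI allI impI)
  show "subalgebra M" by fact
  show "M \<noteq> UNIV" using AM minimal_idealD(2)[OF A(1)] by auto
next
  fix N assume N: "subalgebra N \<and> M \<subseteq> N"
  have "ssum A N = UNIV" using AM(1) N by blast
  then have "ideal (A \<inter> N)" using ideal_abelian_inter A minimal_idealD(1)[OF A(1)] N by blast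
  then consider "A \<inter> N = {0}" | "A \<subseteq> N" using minimal_idealD(4)[OF A(1)] by blast
  then show "N = M \<or> N = UNIV"
  proof cases
    case 1
    have "n \<in> M" if n: "n \<in> N" for n
    proof -
      obtain a m where x: "n = a + m" "a \<in> A" "m \<in> M" using AM by blast
      have "n - m \<in> N" using n x N by (intro subspace_diff subalgebra_subspace) auto
      then have "a \<in> A \<inter> N" using x by simp
      then show ?thesis using 1 x by simp
    qed
    then show ?thesis using N by blast
  next
    case 2
    have "ssum A M \<subseteq> N"
      using N 2 by (intro ssum_least subalgebra_subspace) auto
    then show ?thesis using AM by blast
  qed
qed

text \<open>\<open>A\<close> and its centraliser both meet \<open>M\<close> in an ideal of
  \<open>L\<close>, which core-freeness makes zero; the modular law then shrinks the centraliser to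
  \<open>A\<close>.\<close>

lemma core_free_maximal_subalgebra_complement:
  assumes A: "minimal_ideal scale br A" "abelian br A"
    and M: "maximal_subalgebra scale br M" "core_free scale br M"
  shows "ssum A M = UNIV" "A \<inter> M = {0}" "centraliser br A = A"
proof -
  note A' = minimal_idealD[OF A(1)]
  have sM: "subalgebra M" using M unfolding maximal_subalgebra_def by blast
  have cf: "I = {0}" if "ideal I" "I \<subseteq> M" for I
    using that M(2) core_eq_0_iff unfolding core_free_def by blast
  show AM: "ssum A M = UNIV" using maximal_subalgebra_sum_eq_UNIV[OF M(1) A'(1)] cf A' by blast
  show AM0: "A \<inter> M = {0}" using cf[OF ideal_abelian_inter[OF A'(1) A(2) sM AM]] by simp
  let ?C = "centraliser br A"
  have C: "ideal ?C" by (rule ideal_centraliser[OF A'(1)])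
  have sub: "A \<subseteq> ?C" using A(2) unfolding centraliser_def abelian_def by blast
  \<comment> \<open>Elements of \<open>A\<close> commute with \<open>?C\<close>, so again only the
    component in \<open>M\<close> acts.\<close>
  have "ideal (?C \<inter> M)"
  proof (rule idealI)
    fix x y assume y: "y \<in> ?C \<inter> M"
    obtain a m where x: "x = a + m" "a \<in> A" "m \<in> M" using AM by blast
    have "br y a = 0" using y x unfolding centraliser_def by blast
    then have "br a y = 0" using br_anti[of a y] by simp
    then have "br x y = br m y" using x by (simp add: br_add_left)
    then show "br x y \<in> ?C \<inter> M" using y x ideal_left[OF C] subalgebra_br[OF sM] by auto
  qed (simp add: subspace_inter C sM ideal_subspace subalgebra_subspace)
  then have CM: "?C \<inter> M = {0}" using cf by simp
  have "c \<in> A" if c: "c \<in> ?C" for c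
  proof -
    obtain a m where x: "c = a + m" "a \<in> A" "m \<in> M" using AM by blast
    have "c - a \<in> ?C" using c x sub by (intro subspace_diff ideal_subspace C) auto
    then have "m \<in> ?C \<inter> M" using x by simp
    then show ?thesis using CM x by simp
  qed
  with sub show "?C = A" by blast
qed

text \<open>An ideal \<open>I\<close> inside \<open>M\<close> has \<open>[I, A]\<close> in
  \<open>A \<inter> M = {0}\<close>, so \<open>I\<close> centralises \<open>A\<close> and lies in
  \<open>A \<inter> M\<close>.\<close>

lemma core_free_if_self_centralising:
  assumes A: "ideal A" "centraliser br A = A" "A \<inter> M = {0}"
  shows "core_free scale br M"
  unfolding core_free_def core_eq_0_iff
proof (intro allI impI)
  fix I assume I: "ideal I \<and> I \<subseteq> M"
  have "br i a \<in> A \<inter> M" if "i \<in> I" "a \<in> A" for i a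
    using ideal_right[of I i a] ideal_left[OF A(1) that(2), of i] I that by auto
  then have "I \<subseteq> centraliser br A" unfolding A(3) centraliser_def by blast
  then have "I \<subseteq> {0}" using I A(2,3) by blast
  then show "I = {0}" using I ideal_subspace[of I] subspace_0[of I] by blast
qed

lemma core_free_if_complements_monolith:
  assumes "monolith scale br W" "W \<inter> M = {0}"
  shows "core_free scale br M"
  unfolding core_free_def core_eq_0_iff
proof (intro allI impI)
  fix I assume I: "ideal I \<and> I \<subseteq> M"
  have "W \<noteq> {0}" "0 \<in> W"
    using assms(1) minimal_idealD(2,3) subspace_0 unfolding monolith_def by auto
  then show "I = {0}" using monolith_subset[OF assms(1), of I] I assms(2) by auto
qed

theorem primitive_type1_iff_frattini:
  "primitive_type1 scale br \<longleftrightarrow>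
    (\<exists>W. monolith scale br W \<and> abelian br W) \<and> frattini scale br = {0}"
proof (intro iffI conjI)
  assume L: "primitive_type1 scale br"
  then show "\<exists>W. monolith scale br W \<and> abelian br W" unfolding primitive_type1_def by blast
  obtain M where M: "maximal_subalgebra scale br M" "core_free scale br M"
    using L unfolding primitive_type1_def primitive_def by blast
  then show "frattini scale br = {0}"
    unfolding frattini_def core_free_def core_eq_0_iff by blast
next
  assume *: "(\<exists>W. monolith scale br W \<and> abelian br W) \<and> frattini scale br = {0}"
  then obtain W where W: "monolith scale br W" "abelian br W" by blast
  then have mW: "minimal_ideal scale br W" unfolding monolith_def by blast
  \<comment> \<open>The nonzero ideal \<open>W\<close> cannot lie in the intersection of all maximal
    subalgebras, which would be \<open>UNIV\<close> if there were none. A maximal subalgebra not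
    containing \<open>W\<close> contains no nonzero ideal.\<close>
  then obtain M where M: "maximal_subalgebra scale br M" "\<not> W \<subseteq> M"
    using * minimal_idealD(1,2)[OF mW] unfolding frattini_def core_eq_0_iff by blast
  then have "core_free scale br M"
    unfolding core_free_def core_eq_0_iff using monolith_subset[OF W(1)] by blast
  then show "primitive_type1 scale br"
    using M W unfolding primitive_type1_def primitive_def by blast
qed

subsection \<open>Actions on a minimal ideal\<close>

text \<open>The trace argument, with \<open>X\<close> and \<open>Y\<close> left free:
  \<open>Y\<close> is all of \<open>L\<close> when \<open>z\<close> is central modulo
  \<open>W\<close>, and an ideal when that ideal is abelian modulo \<open>W\<close>.\<close>

lemma bracket_not_injective:
  assumes char: "CHAR('k) = 0" and W: "ideal W" "W \<noteq> {0}" and z: "z \<in> brackets X Y"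
    and comm: "\<And>y w. y \<in> Y \<Longrightarrow> w \<in> W \<Longrightarrow> br z (br y w) = br y (br z w)"
  shows "\<exists>w\<in>W. w \<noteq> 0 \<and> br z w = 0"
proof (rule ccontr)
  assume inj: "\<not> (\<exists>w\<in>W. w \<noteq> 0 \<and> br z w = 0)"
  have sW: "subspace W" by (rule ideal_subspace[OF W(1)])
  have brW: "br x w \<in> W" if "w \<in> W" for x w using ideal_left[OF W(1) that] .
  obtain g where g: "Vector_Spaces.linear scale scale g" "range g \<subseteq> W"
      and gz: "\<And>w. w \<in> W \<Longrightarrow> g (br z w) = w" and zg: "\<And>w. w \<in> W \<Longrightarrow> br z (g w) = w"
    using linear_inverse_on[OF linear_br[of z] sW] inj brW by blast
  have gW: "g x \<in> W" for x using g(2) by blast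
  \<comment> \<open>An operator commuting with \<open>z\<close> on \<open>W\<close> commutes with
    its inverse \<open>g\<close>.\<close>
  have gcomm: "g (br y w) = br y (g w)" if "y \<in> Y" "w \<in> W" for y w
    using gz[OF brW[OF gW, of y w]] comm[OF that(1) gW, of w] zg[OF that(2)] by simp
  obtain B where B: "B \<subseteq> W" "independent B" "W \<subseteq> span B" by (rule maximal_independent_subset)
  have WB: "span B = W" using B span_minimal[OF B(1) sW] by blast
  have BW: "b \<in> W" if "b \<in> B" for b using B that by blast
  have tr0: "trace_on B (\<lambda>w. br (br x y) (g w)) = 0" if y: "y \<in> Y" for x y
  proof -
    have lin: "Vector_Spaces.linear scale scale (\<lambda>w. br x (g w))"
      using Vector_Spaces.linear_compose[OF g(1) linear_br] by (simp add: o_def)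
    \<comment> \<open>Cyclicity moves \<open>y\<close> behind \<open>x g\<close>, and
      \<open>y\<close> then passes \<open>g\<close>; so \<open>x y g\<close> and
      \<open>y x g\<close> have equal trace.\<close>
    have "trace_on B (\<lambda>w. br y (br x (g w))) = trace_on B (\<lambda>w. br x (g (br y w)))"
      by (rule trace_on_comm[OF B(2) linear_br _ lin]) (auto simp: WB brW gW)
    also have "\<dots> = trace_on B (\<lambda>w. br x (br y (g w)))"
      by (rule trace_on_cong[OF B(2)]) (simp add: WB gcomm[OF y])
    moreover have "trace_on B (\<lambda>w. br (br x y) (g w))
        = trace_on B (\<lambda>w. br x (br y (g w)) - br y (br x (g w)))"
      by (simp add: br_leibniz[of x y])
    ultimately show ?thesis using trace_on_diff[OF B(2)] by (simp add: WB brW gW)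
  qed
  have "trace_on B (\<lambda>w. br z (g w)) = 0"
    using z
  proof (induction rule: span_induct_alt)
    case base
    then show ?case by (simp add: trace_on_def representation_zero)
  next
    case (step c x y)
    then obtain a b where x: "x = br a b" "b \<in> Y" by blast
    have "trace_on B (\<lambda>w. br (c *s x + y) (g w)) = c * trace_on B (\<lambda>w. br x (g w)) + trace_on B (\<lambda>w. br y (g w))"
      by (simp add: br_add_left br_scale_left trace_on_add[OF B(2)] trace_on_scale[OF B(2)]
          WB brW gW subspace_scale[OF sW])
    then show ?case using step x tr0 by simp
  qed
  moreover have "trace_on B (\<lambda>w. br z (g w)) = trace_on B (\<lambda>w. w)"
    by (rule trace_on_cong[OF B(2)]) (simp add: WB zg)
  ultimately have "of_nat (card B) = (0 :: 'k)" by (simp add: trace_on_id[OF B(2)])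
  \<comment> \<open>The trace of the identity is \<open>dim W\<close> read in the field, which
    characteristic zero detects.\<close>
  then have "card B = 0" using char by (simp add: of_nat_eq_0_iff_char_dvd)
  then have "B = {}" using finiteI_independent[OF B(2)] by simp
  then show False using WB W(2) by simp
qed

lemma minimal_ideal_eq:
  assumes "minimal_ideal scale br W" "subspace N" "N \<subseteq> W"
    "\<And>x w. w \<in> N \<Longrightarrow> br x w \<in> N" "w \<in> N" "w \<noteq> 0"
  shows "N = W"
  using minimal_idealD(4)[OF assms(1) idealI[OF assms(2,4)] assms(3)] assms(5,6) by auto

text \<open>Schur's argument: the kernel of \<open>z\<close> on \<open>W\<close> is a nonzero ideal,
  hence \<open>W\<close>.\<close>

lemma commuting_kernel:
  assumes W: "minimal_ideal scale br W" and z: "\<And>x w. w \<in> W \<Longrightarrow> br z (br x w) = br x (br z w)"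
    and w: "w \<in> W" "w \<noteq> 0" "br z w = 0"
  shows "z \<in> centraliser br W"
proof -
  note W' = minimal_idealD[OF W]
  have "{w \<in> W. br z w = 0} = W"
  proof (rule minimal_ideal_eq[OF W])
    have "{w \<in> W. br z w = 0} = W \<inter> {w. br z w \<in> {0}}" by auto
    then show "subspace {w \<in> W. br z w = 0}"
      using subspace_inter[OF W'(3) subspace_br_preimage[OF subspace_single_0]] by simp
  qed (use w z ideal_left[OF W'(1)] in auto)
  then show ?thesis unfolding centraliser_def by blast
qed

text \<open>The Fitting null component of \<open>b\<close> on \<open>W\<close> is an ideal: moving
  \<open>b\<close> past any \<open>y\<close> costs \<open>[b, y]\<close>, which lies in
  \<open>B\<close> and commutes with \<open>b\<close> on \<open>W\<close>. It is nonzero, hence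
  \<open>W\<close>.\<close>

lemma nilpotent_on_if_singular:
  assumes W: "minimal_ideal scale br W" and B: "ideal B"
    and comm: "\<And>b c w. b \<in> B \<Longrightarrow> c \<in> B \<Longrightarrow> w \<in> W \<Longrightarrow> br b (br c w) = br c (br b w)"
    and b: "b \<in> B" and w: "w \<in> W" "w \<noteq> 0" "br b w = 0" and v: "v \<in> W"
  shows "\<exists>n. (br b ^^ n) v = 0"
proof -
  note W' = minimal_idealD[OF W]
  have powW: "(br b ^^ n) v \<in> W" if "v \<in> W" for n v
    using that by (induction n) (auto intro: ideal_left[OF W'(1)])
  have lin: "Vector_Spaces.linear scale scale (br b ^^ n)" for n
  proof (induction n)
    case 0
    then show ?case by unfold_locales simp_all
  next
    case (Suc n)
    then show ?case using Vector_Spaces.linear_compose[OF Suc linear_br[of b]] by (simp add: o_def)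
  qed
  have pow0: "(br b ^^ n) 0 = 0" for n by (induction n) simp_all
  have mono: "(br b ^^ (n + k)) v = 0" if "(br b ^^ n) v = 0" for n k v
    using that by (simp add: add.commute[of n] funpow_add pow0)
  have powc: "(br b ^^ n) (br c v) = br c ((br b ^^ n) v)" if "c \<in> B" "v \<in> W" for n c v
    by (induction n) (simp_all add: comm[OF b that(1)] powW that(2))
  \<comment> \<open>One additional power of \<open>b\<close> suffices: the term with
    \<open>[b, y]\<close> dies since that commutes with \<open>b\<close>, and \<open>br b v\<close>
    is killed by one power less.\<close>
  have step: "(br b ^^ Suc n) (br y v) = 0" if "v \<in> W" "(br b ^^ n) v = 0" for n y v
    using that
  proof (induction n arbitrary: v)
    case (Suc n)
    let ?d = "br b y"
    have "?d \<in> B" using ideal_right[OF B b] .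
    have "(br b ^^ Suc (Suc n)) (br y v) = (br b ^^ Suc n) (br ?d v + br y (br b v))"
      by (simp only: funpow_Suc_right o_apply br_leibniz[of b y])
    also have "\<dots> = (br b ^^ Suc n) (br ?d v) + (br b ^^ Suc n) (br y (br b v))"
      using module_hom.add[OF Vector_Spaces.linear.axioms(3)[OF lin]] .
    also have "(br b ^^ Suc n) (br ?d v) = 0" by (simp only: powc[OF \<open>?d \<in> B\<close> Suc.prems(1)] Suc.prems(2) br_zero_right)
    also have "(br b ^^ Suc n) (br y (br b v)) = 0"
      using Suc.prems by (intro Suc.IH ideal_left[OF W'(1)]) (simp_all only: funpow_Suc_right o_apply)
    finally show ?case by simp
  qed simp
  let ?N = "{v \<in> W. \<exists>n. (br b ^^ n) v = 0}"
  have "?N = W"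
  proof (rule minimal_ideal_eq[OF W])
    show "subspace ?N"
      unfolding subspace_def
    proof (intro conjI ballI allI)
      show "0 \<in> ?N" using subspace_0[OF W'(3)] pow0 by auto
    next
      fix u v assume uv: "u \<in> ?N" "v \<in> ?N"
      then obtain n m where nm: "(br b ^^ n) u = 0" "(br b ^^ m) v = 0" by blast
      have "(br b ^^ (n + m)) (u + v) = 0"
        using mono[OF nm(1), of m] mono[OF nm(2), of n] module_hom.add[OF Vector_Spaces.linear.axioms(3)[OF lin]] by (simp add: add.commute)
      then show "u + v \<in> ?N" using uv subspace_add[OF W'(3)] by blast
    next
      fix c v assume "v \<in> ?N"
      then show "c *s v \<in> ?N" using subspace_scale[OF W'(3)] module_hom.scale[OF Vector_Spaces.linear.axioms(3)[OF lin]] by force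
    qed
    show "br x v \<in> ?N" if "v \<in> ?N" for x v using that step ideal_left[OF W'(1)] by blast
    show "w \<in> ?N" using w by (auto intro: exI[of _ 1])
  qed (use w in auto)
  then show ?thesis using v by blast
qed

text \<open>Take the iterate just before the first that vanishes.\<close>

lemma kernel_of_nilpotent:
  assumes "(f ^^ n) v = (0::'v)" "v \<noteq> 0"
  obtains m where "(f ^^ m) v \<noteq> 0" "f ((f ^^ m) v) = 0"
proof -
  define k where "k = (LEAST n. (f ^^ n) v = 0)"
  have k: "(f ^^ k) v = 0" unfolding k_def using assms(1) by (rule LeastI)
  then obtain m where m: "k = Suc m" using assms(2) by (cases k) auto
  have "(f ^^ m) v \<noteq> 0" using not_less_Least[of m "\<lambda>n. (f ^^ n) v = 0"] m unfolding k_def by simp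
  then show thesis using that k m by simp
qed

text \<open>Otherwise every element of \<open>B\<close> is nilpotent on \<open>W\<close>, hence zero
  on a minimal \<open>B\<close>-stable subspace \<open>U\<close>. The common kernel of
  \<open>B\<close> on \<open>W\<close> is then a nonzero ideal, so \<open>B\<close> centralises
  \<open>W\<close>.\<close>

lemma exists_injective:
  assumes W: "minimal_ideal scale br W" and B: "ideal B"
    and comm: "\<And>b c w. b \<in> B \<Longrightarrow> c \<in> B \<Longrightarrow> w \<in> W \<Longrightarrow> br b (br c w) = br c (br b w)"
    and ncent: "\<not> B \<subseteq> centraliser br W"
  shows "\<exists>b\<in>B. \<forall>w\<in>W. br b w = 0 \<longrightarrow> w = 0"
proof (rule ccontr)
  assume "\<not> ?thesis"
  then have sing: "\<exists>w\<in>W. w \<noteq> 0 \<and> br b w = 0" if "b \<in> B" for b using that by blast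
  note W' = minimal_idealD[OF W]
  let ?P = "\<lambda>U. subspace U \<and> (\<forall>b\<in>B. \<forall>u\<in>U. br b u \<in> U)"
  have PW: "?P W" using W' ideal_left by blast
  obtain U where U: "?P U" "U \<noteq> {0}" "U \<subseteq> W"
    and min: "\<And>T. ?P T \<Longrightarrow> T \<subseteq> U \<Longrightarrow> T = {0} \<or> T = U"
    using exists_minimal_subspace[of ?P W, OF PW W'(2)] by blast
  have ker: "br b u = 0" if b: "b \<in> B" and u: "u \<in> U" for b u
  proof -
    \<comment> \<open>\<open>?K\<close> is \<open>B\<close>-stable because \<open>B\<close> acts
      commutatively; nilpotency of \<open>b\<close> makes it nonzero, so it is
      \<open>U\<close>.\<close>
    let ?K = "{u \<in> U. br b u = 0}"
    have "?K = U \<inter> {u. br b u \<in> {0}}" by auto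
    then have "subspace ?K" using subspace_inter[OF _ subspace_br_preimage[of "{0}" b]] U(1) by simp
    moreover have "\<forall>c\<in>B. \<forall>u\<in>?K. br c u \<in> ?K" using U comm[OF b] by auto
    ultimately have "?K = {0} \<or> ?K = U" by (intro min) auto
    moreover obtain v where v: "v \<in> U" "v \<noteq> 0" using U(2) subspace_0[of U] U(1) by blast
    have pow: "(br b ^^ n) v \<in> U" for n using v U(1) b by (induction n) auto
    obtain w where w: "w \<in> W" "w \<noteq> 0" "br b w = 0" using sing[OF b] by blast
    have "\<exists>n. (br b ^^ n) v = 0"
      using nilpotent_on_if_singular[OF W B comm b w, of v] v U(3) by blast
    then obtain m where "(br b ^^ m) v \<noteq> 0" "br b ((br b ^^ m) v) = 0"
      using kernel_of_nilpotent v(2) by metis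
    then have "?K \<noteq> {0}" using pow by blast
    ultimately show ?thesis using u by blast
  qed
  obtain u where u: "u \<in> U" "u \<noteq> 0" using U(2) subspace_0[of U] U(1) by blast
  let ?N = "{w \<in> W. \<forall>b\<in>B. br b w = 0}"
  have "?N = W"
  proof (rule minimal_ideal_eq[OF W])
    show "subspace ?N"
      using W'(3) unfolding subspace_def by (auto simp: br_add_right br_scale_right)
    \<comment> \<open>In \<open>[b, [x, w]] = [[b, x], w] + [x, [b, w]]\<close> both terms vanish,
      as \<open>[b, x]\<close> is again in \<open>B\<close>.\<close>
    show "br x w \<in> ?N" if w: "w \<in> ?N" for x w
    proof -
      have "br b (br x w) = 0" if "b \<in> B" for b
        using br_leibniz[of b x w] ideal_right[OF B that, of x] w that by simp
      then show ?thesis using w ideal_left[OF W'(1)] by blast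
    qed
    show "u \<in> ?N" using u U(3) ker by blast
  qed (use u in auto)
  then show False using ncent unfolding centraliser_def by blast
qed

lemma commute_on_if_bracket_centralises:
  "br b c \<in> centraliser br W \<Longrightarrow> w \<in> W \<Longrightarrow> br b (br c w) = br c (br b w)"
  by (simp add: br_leibniz[of b c] centraliser_def)

subsection \<open>Solvable ideals over a self-centralising minimal ideal\<close>

context
  fixes W
  assumes char: "CHAR('k) = 0" and W: "minimal_ideal scale br W" and cent: "centraliser br W = W"
begin

text \<open>Such a \<open>z\<close> commutes with every operator from \<open>L\<close> on
  \<open>W\<close>. The trace argument makes it singular, so by Schur it centralises
  \<open>W\<close>.\<close>

lemma central_bracket_in_self_centralising:
  assumes z: "z \<in> brackets UNIV UNIV" and c: "\<And>x. br z x \<in> W"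
  shows "z \<in> W"
proof -
  have comm: "br z (br x w) = br x (br z w)" if "w \<in> W" for x w
    using commute_on_if_bracket_centralises[of z x W w] c cent that by simp
  obtain w where "w \<in> W" "w \<noteq> 0" "br z w = 0"
    using bracket_not_injective[OF char minimal_idealD(1,2)[OF W] z comm] by blast
  then show ?thesis using commuting_kernel[OF W comm] cent by blast
qed

text \<open>\<open>I\<close> acts on \<open>W\<close> by commuting operators. If
  \<open>[L, I]\<close> were not inside \<open>W\<close>, one of its elements would act injectively,
  against the trace argument with \<open>Y = I\<close>.\<close>

lemma abelian_ideal_mod_central:
  assumes I: "ideal I" and ab: "brackets I I \<subseteq> W"
  shows "brackets UNIV I \<subseteq> W"
proof (rule ccontr)
  let ?B = "brackets UNIV I"
  assume not: "\<not> ?B \<subseteq> W"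
  have B: "ideal ?B" by (rule ideal_brackets[OF ideal_UNIV I])
  have BI: "?B \<subseteq> I" by (intro brackets_least ideal_subspace ideal_left I)
  have comm: "br b (br c w) = br c (br b w)" if "b \<in> I" "c \<in> I" "w \<in> W" for b c w
    using commute_on_if_bracket_centralises[of b c W w] br_in_brackets[OF that(1,2)] ab cent that by auto
  obtain b where b: "b \<in> ?B" "\<forall>w\<in>W. br b w = 0 \<longrightarrow> w = 0"
    using exists_injective[OF W B] comm BI not cent by (metis (no_types, lifting) subsetD)
  show False
    using bracket_not_injective[OF char minimal_idealD(1,2)[OF W] b(1)] comm[of b] b BI by blast
qed

text \<open>Climb the derived series: a term that is abelian modulo \<open>W\<close> is central
  modulo \<open>W\<close>, and if it also lies in \<open>[L, L]\<close> it falls into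
  \<open>W\<close>.\<close>

lemma solvable_ideal_mod_central:
  assumes I: "ideal I" and sol: "derived scale br n I \<subseteq> W" and x: "x \<in> I"
  shows "br y x \<in> W"
proof -
  \<comment> \<open>The climb ends at \<open>[I, I]\<close>, since \<open>I\<close> itself may not
    lie in \<open>[L, L]\<close>; one more use of centrality gives the claim for
    \<open>I\<close>.\<close>
  have d: "brackets I I \<subseteq> W" if "derived scale br (Suc n) I \<subseteq> W" for n
    using that
  proof (induction n)
    case (Suc n)
    let ?J = "derived scale br (Suc n) I"
    have J: "brackets UNIV ?J \<subseteq> W"
      using abelian_ideal_mod_central[OF ideal_derived[OF I, of "Suc n"]] Suc.prems by simp
    have "?J \<subseteq> brackets UNIV UNIV" unfolding derived.simps by (rule span_mono) blast
    moreover have "br z x \<in> W" if "z \<in> ?J" for z x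
      using br_in_brackets[OF UNIV_I that, of x] J br_anti[of z x]
        subspace_neg[OF minimal_idealD(3)[OF W]] by auto
    ultimately have "?J \<subseteq> W" using central_bracket_in_self_centralising by blast
    then show ?case by (rule Suc.IH)
  qed simp
  show ?thesis
  proof (cases n)
    case 0
    then show ?thesis using sol x ideal_left[OF minimal_idealD(1)[OF W]] by auto
  next
    case (Suc m)
    then show ?thesis
      using abelian_ideal_mod_central[OF I d] sol br_in_brackets[OF UNIV_I x] by blast
  qed
qed

end

text \<open>Adding \<open>W\<close> does not change the derived series modulo \<open>W\<close>. It
  is used for an \<open>I\<close> that becomes an ideal of \<open>L\<close> only after
  \<open>W\<close> is added.\<close>

lemma derived_ssum_ideal:
  assumes W: "ideal W"
  shows "derived scale br n (ssum I W) \<subseteq> ssum (derived scale br n I) W"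
proof (induction n)
  case (Suc n)
  have sub: "subspace (ssum (derived scale br (Suc n) I) W)"
    by (simp add: subspace_sums ideal_subspace W)
  have "br x y \<in> ssum (derived scale br (Suc n) I) W"
    if xy: "x \<in> derived scale br n (ssum I W)" "y \<in> derived scale br n (ssum I W)" for x y
  proof -
    obtain a v b w where *: "x = a + v" "y = b + w" "a \<in> derived scale br n I" "b \<in> derived scale br n I"
      "v \<in> W" "w \<in> W" using Suc xy by blast
    have "br x y = br a b + (br a w + br v y)"
      unfolding * by (simp add: br_add_left br_add_right)
    moreover have "br a b \<in> derived scale br (Suc n) I" using * br_in_brackets by simp
    moreover have "br a w + br v y \<in> W"
      using * W by (intro subspace_add ideal_subspace) (auto intro: ideal_left ideal_right)
    ultimately show ?thesis by blast
  qed
  then have "brackets (derived scale br n (ssum I W)) (derived scale br n (ssum I W))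
      \<subseteq> ssum (derived scale br (Suc n) I) W" by (rule brackets_least[OF sub])
  then show ?case by simp
qed simp

subsection \<open>Semisimple action\<close>

text \<open>The sum of the simple \<open>c\<close>-submodules is an ideal, since operators commuting with \<open>c\<close>
  map simple submodules to simple submodules or to zero.\<close>

lemma acts_semisimply_if_commutes:
  assumes W: "minimal_ideal scale br W"
    and c: "\<And>x w. w \<in> W \<Longrightarrow> br c (br x w) = br x (br c w)"
  shows "acts_semisimply scale (br c) W"
  unfolding acts_semisimply_def
proof (intro allI impI)
  fix U assume U: "subspace U \<and> U \<subseteq> W \<and> br c ` U \<subseteq> U"
  note W' = minimal_idealD[OF W]
  let ?P = "\<lambda>T. subspace T \<and> T \<subseteq> W \<and> br c ` T \<subseteq> T"
  define simple where "simple Q \<longleftrightarrow> ?P Q \<and> Q \<noteq> {0} \<and> (\<forall>T. ?P T \<and> T \<subseteq> Q \<longrightarrow> T = {0} \<or> T = Q)" for Q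
  have PW: "?P W" using W' ideal_left by blast
  obtain Q0 where Q0: "simple Q0"
    using exists_minimal_subspace[of ?P W, OF PW W'(2)] unfolding simple_def by (metis (no_types, lifting))
  have simple_image: "simple (br x ` Q) \<or> br x ` Q = {0}" if Q: "simple Q" for x Q
  proof -
    have PQ: "?P Q" using Q unfolding simple_def by blast
    have "subspace (br x ` Q)"
      using module_hom.subspace_image[OF Vector_Spaces.linear.axioms(3)[OF linear_br]] PQ by blast
    moreover have "br x ` Q \<subseteq> W" using PQ ideal_left[OF W'(1)] by blast
    moreover have "br c ` br x ` Q \<subseteq> br x ` Q" using PQ c by (force simp: image_subset_iff)
    moreover have "T = {0} \<or> T = br x ` Q" if T: "?P T" "T \<subseteq> br x ` Q" for T
    proof -
      \<comment> \<open>Pull \<open>T\<close> back to \<open>Q\<close>: the preimage is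
        \<open>c\<close>-stable, so simplicity of \<open>Q\<close> leaves only zero and
        \<open>Q\<close>.\<close>
      let ?K = "{q \<in> Q. br x q \<in> T}"
      have "?K = Q \<inter> {q. br x q \<in> T}" by auto
      then have "subspace ?K" using subspace_inter subspace_br_preimage PQ T(1) by metis
      moreover have "br c ` ?K \<subseteq> ?K"
      proof -
        have "br x (br c q) \<in> T" if "q \<in> ?K" for q
          using c[of q x] that PQ T(1) by (metis (no_types, lifting) image_subset_iff mem_Collect_eq subsetD)
        then show ?thesis using PQ by blast
      qed
      ultimately have "?P ?K \<and> ?K \<subseteq> Q" using PQ by blast
      then consider "?K = {0}" | "?K = Q" using Q unfolding simple_def by blast
      then show ?thesis
      proof cases
        case 1
        have "t = 0" if t: "t \<in> T" for t
        proof -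
          obtain q where q: "q \<in> Q" "t = br x q" using T(2) t by blast
          then have "q \<in> ?K" using t by blast
          then show ?thesis using 1 q by simp
        qed
        then show ?thesis using subspace_0[of T] T(1) by blast
      next
        case 2
        then show ?thesis using T(2) by blast
      qed
    qed
    ultimately have "br x ` Q \<noteq> {0} \<longrightarrow> simple (br x ` Q)" unfolding simple_def by simp
    then show ?thesis by blast
  qed
  let ?N = "span (\<Union>{Q. simple Q})"
  have "?N = W"
  proof -
    have "\<Union>{Q. simple Q} \<subseteq> W" unfolding simple_def by blast
    then have NW: "?N \<subseteq> W" by (rule span_minimal) (rule W'(3))
    have "br x w \<in> ?N" if w: "w \<in> ?N" for x w
    proof -
      have "br x q \<in> ?N" if "simple Q" "q \<in> Q" for q Q
        using simple_image[OF that(1), of x] that(2) span_zero by (metis (mono_tags, lifting)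
          UnionI image_eqI mem_Collect_eq singletonD span_base)
      then have "\<Union>{Q. simple Q} \<subseteq> {w. br x w \<in> ?N}" by blast
      then have "?N \<subseteq> {w. br x w \<in> ?N}" by (rule span_minimal) (simp add: subspace_br_preimage)
      then show ?thesis using w by blast
    qed
    moreover obtain q where "q \<in> Q0" "q \<noteq> 0"
      using Q0 subspace_0[of Q0] unfolding simple_def by blast
    moreover have "q \<in> ?N" using \<open>q \<in> Q0\<close> Q0 by (auto intro: span_base)
    ultimately show ?thesis using minimal_ideal_eq[OF W subspace_span NW] by blast
  qed
  then have Q: "\<exists>Q. ?P Q \<and> Q \<subseteq> W \<and> Q \<inter> T = {0} \<and> Q \<noteq> {0}" if T: "?P T" "T \<noteq> W" for T
  proof -
    \<comment> \<open>The simple submodules span \<open>W\<close>, so one of them is not inside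
      \<open>T\<close>; by simplicity it meets \<open>T\<close> trivially.\<close>
    obtain Q where Q: "simple Q" "\<not> Q \<subseteq> T"
      using \<open>?N = W\<close> span_minimal[of "\<Union>{Q. simple Q}" T] T by blast
    then have PQ: "?P Q" "Q \<noteq> {0}" unfolding simple_def by auto
    then have "?P (Q \<inter> T)" using T subspace_inter by blast
    then have "Q \<inter> T = {0}" using Q unfolding simple_def by blast
    then show ?thesis using PQ by blast
  qed
  have sum: "?P (ssum S T)" if "?P S" "?P T" for S T
  proof -
    have "br c x \<in> ssum S T" if x: "x \<in> ssum S T" for x
    proof -
      obtain s t where st: "x = s + t" "s \<in> S" "t \<in> T" using x by blast
      have "br c s \<in> S" "br c t \<in> T" using \<open>?P S\<close> \<open>?P T\<close> st by auto
      then show ?thesis unfolding st(1) br_add_right by blast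
    qed
    moreover have "ssum S T \<subseteq> W" using that ssum_least[OF W'(3)] by simp
    moreover have "subspace (ssum S T)" using that subspace_sums by simp
    ultimately show ?thesis by (simp add: image_subset_iff)
  qed
  have P0: "?P {0}" using subspace_0[OF W'(3)] by simp
  have U0: "U \<inter> {0} = {0}" using U subspace_0 by blast
  show "\<exists>V. subspace V \<and> V \<subseteq> W \<and> br c ` V \<subseteq> V \<and> U \<inter> V = {0} \<and>
      {u + v |u v. u \<in> U \<and> v \<in> V} = W"
  proof (rule exists_complement_extending[of ?P W U "{0}"])
    fix V assume "?P V" "U \<inter> V = {0}" "ssum U V = W"
    then show ?thesis by auto
  next
    show "?P (ssum S T)" if "?P S" "?P T" for S T using that by (rule sum)
    show "\<exists>Q. ?P Q \<and> Q \<subseteq> W \<and> Q \<inter> T = {0} \<and> Q \<noteq> {0}" if "?P T" "T \<noteq> W" for T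
      using that by (rule Q)
  qed (use PW U P0 U0 in simp_all)
qed

subsection \<open>Primitive algebras of type 1 in characteristic zero\<close>

theorem primitive_type1_iff_decomposition:
  assumes char: "CHAR('k) = 0"
  shows "primitive_type1 scale br \<longleftrightarrow>
     (\<exists>W C S. monolith scale br W \<and> abelian br W \<and>
        lie_subalgebra scale br C \<and> abelian br C \<and>
        (\<forall>c\<in>C. acts_semisimply scale (br c) W) \<and>
        levi_subalgebra scale br S \<and>
        (\<forall>c\<in>C. \<forall>s\<in>S. br c s = 0) \<and>
        C \<inter> S = {0} \<and>
        W \<inter> {c + s | c s. c \<in> C \<and> s \<in> S} = {0} \<and>
        {w + c + s | w c s. w \<in> W \<and> c \<in> C \<and> s \<in> S} = UNIV)" (is "_ \<longleftrightarrow> ?R")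
proof
  assume L: "primitive_type1 scale br"
  then obtain W where mon: "monolith scale br W" and abW: "abelian br W"
    unfolding primitive_type1_def by blast
  then have W: "minimal_ideal scale br W" unfolding monolith_def by blast
  obtain M where M: "maximal_subalgebra scale br M" "core_free scale br M"
    using L unfolding primitive_type1_def primitive_def by blast
  note W' = minimal_idealD[OF W]
  note WM = core_free_maximal_subalgebra_complement[OF W abW M]
  have sM: "subalgebra M" using M unfolding maximal_subalgebra_def by blast
  note sM' = subalgebra_subspace[OF sM]
  \<comment> \<open>The elements of \<open>M\<close> central modulo \<open>W\<close>. As
    \<open>[C, M]\<close> lies in \<open>W \<inter> M = {0}\<close>, this is the centre of
    \<open>M\<close>, in the form that the lemmas on self-centralising ideals deliver.\<close>
  define C where "C = {m \<in> M. \<forall>x. br m x \<in> W}"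
  have C_eq: "C = M \<inter> (\<Inter>x. {m. br m x \<in> W})" unfolding C_def by auto
  have sC: "subspace C"
    unfolding C_eq by (intro subspace_inter sM' subspace_Inter) (auto simp: subspace_br_left_preimage W'(3))
  have CM: "C \<subseteq> M" unfolding C_def by blast
  have cM: "br c m = 0" if "c \<in> C" "m \<in> M" for c m
    using that WM(2) subalgebra_br[OF sM, of c m] unfolding C_def by blast
  let ?D = "brackets M M"
  have DM: "?D \<subseteq> M" by (intro brackets_least sM' subalgebra_br[OF sM])
  have "z = 0" if z: "z \<in> C" "z \<in> ?D" for z
  proof -
    have "?D \<subseteq> brackets UNIV UNIV" by (rule span_mono) blast
    then have "z \<in> W"
      using z central_bracket_in_self_centralising[OF char W WM(3), of z] unfolding C_def by blast
    then show ?thesis using WM(2) z CM by blast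
  qed
  then have CD: "C \<inter> ?D = {0}" using subspace_0[OF sC] span_zero by blast
  obtain S where S: "subspace S" "?D \<subseteq> S" "S \<subseteq> M" "C \<inter> S = {0}" "ssum C S = M"
    using exists_subspace_complement_extending[OF sM' sC CM subspace_span DM CD] .
  have brS: "br x y \<in> S" if "x \<in> M" "y \<in> M" for x y using br_in_brackets[OF that] S(2) by blast
  have subS: "subalgebra S" using S(1,3) brS by (intro subalgebraI) auto
  have subC: "subalgebra C" using sC cM CM subspace_0[OF sC] by (intro subalgebraI) auto
  have decomp: "\<exists>w\<in>W. \<exists>c\<in>C. \<exists>s\<in>S. x = w + c + s" for x
  proof -
    obtain w m where x: "x = w + m" "w \<in> W" "m \<in> M" using WM(1) by blast
    then obtain c s where "m = c + s" "c \<in> C" "s \<in> S" using S(5) by blast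
    then show ?thesis using x by (metis add.assoc)
  qed
  \<comment> \<open>\<open>I\<close> need only be an ideal modulo \<open>W\<close>:
    \<open>ssum I W\<close> is solvable modulo \<open>W\<close>, hence central modulo
    \<open>W\<close>.\<close>
  have solv_M: "i \<in> C" if I: "ideal (ssum I W)" "derived scale br n I \<subseteq> W" and i: "i \<in> I" "i \<in> M" for I n i
  proof -
    have "derived scale br n (ssum I W) \<subseteq> W"
      using derived_ssum_ideal[OF W'(1), of n I] ssum_least[OF W'(3) I(2) order_refl] by blast
    moreover have "i \<in> ssum I W" using i ssum_left[OF W'(3)] by blast
    ultimately have "br y i \<in> W" for y
      using solvable_ideal_mod_central[OF char W WM(3) I(1)] by blast
    then have "br i y \<in> W" for y using br_anti[of i y] subspace_neg[OF W'(3)] by simp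
    then show ?thesis using i unfolding C_def by blast
  qed
  \<comment> \<open>\<open>W + C\<close> is an ideal as \<open>C\<close> is central modulo
    \<open>W\<close>, and its derived algebra lies in the abelian \<open>W\<close>. Conversely a
    solvable ideal is central modulo \<open>W\<close>, so its components in \<open>M\<close> lie in
    \<open>C\<close>.\<close>
  have rad: "radical scale br = ssum W C"
  proof
    have "ideal (ssum W C)"
    proof (rule idealI)
      fix x y assume "y \<in> ssum W C"
      then obtain w c where y: "y = w + c" "w \<in> W" "c \<in> C" by blast
      have "br x c \<in> W" using y(3) br_anti[of x c] subspace_neg[OF W'(3)] unfolding C_def by simp
      then have "br x y \<in> W"
        unfolding y(1) br_add_right using y ideal_left[OF W'(1)] by (intro subspace_add W'(3))
      then show "br x y \<in> ssum W C" using ssum_left[OF sC] by blast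
    qed (simp add: subspace_sums W'(3) sC)
    moreover have "solvable_set scale br (ssum W C)"
    proof -
      have "br x y = 0" if xy: "x \<in> brackets (ssum W C) (ssum W C)" "y \<in> brackets (ssum W C) (ssum W C)" for x y
      proof -
        have "br x y \<in> W" if mem: "x \<in> ssum W C" "y \<in> ssum W C" for x y
        proof -
          obtain w c v d where *: "x = w + c" "y = v + d" "w \<in> W" "v \<in> W" "c \<in> C" "d \<in> C"
            using mem by blast
          have "br x y = br w y + br c v + br c d" unfolding * by (simp add: br_add_left br_add_right add.assoc)
          moreover have "br c d = 0" using cM * CM by blast
          ultimately show ?thesis
            using ideal_left[OF W'(1) *(4), of c] ideal_right[OF W'(1) *(3), of y] subspace_add[OF W'(3)] by simp
        qed
        then have "brackets (ssum W C) (ssum W C) \<subseteq> W" by (rule brackets_least[OF W'(3)])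
        then show ?thesis using xy abW unfolding abelian_def by blast
      qed
      then have "derived scale br 2 (ssum W C) \<subseteq> {0}"
        unfolding numeral_2_eq_2 derived.simps by (intro brackets_least) auto
      moreover have "0 \<in> derived scale br 2 (ssum W C)" unfolding numeral_2_eq_2 by (simp add: span_zero)
      ultimately show ?thesis unfolding solvable_set_def by blast
    qed
    ultimately show "ssum W C \<subseteq> radical scale br"
      unfolding radical_def by (intro subsetI span_base) blast
  next
    have "I \<subseteq> ssum W C" if I: "ideal I" "solvable_set scale br I" for I
    proof
      fix i assume i: "i \<in> I"
      obtain n where n: "derived scale br n I = {0}" using I(2) unfolding solvable_set_def by blast
      have "derived scale br n I \<subseteq> W" using n subspace_0[OF W'(3)] by simp
      then have iW: "br y i \<in> W" for y
        using solvable_ideal_mod_central[OF char W WM(3) I(1) _ i] by blast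
      obtain w m where x: "i = w + m" "w \<in> W" "m \<in> M" using WM(1) by blast
      have "br m y \<in> W" for y
      proof -
        have "br m y = br i y - br w y" using x(1) by (simp add: br_add_left)
        moreover have "br i y \<in> W" using iW[of y] br_anti[of i y] subspace_neg[OF W'(3)] by simp
        ultimately show ?thesis
          using ideal_right[OF W'(1) x(2), of y] subspace_diff[OF W'(3)] by simp
      qed
      then show "i \<in> ssum W C" using x unfolding C_def by blast
    qed
    then show "radical scale br \<subseteq> ssum W C"
      unfolding radical_def by (intro span_minimal) (auto simp: subspace_sums W'(3) sC)
  qed
  \<comment> \<open>Since \<open>C\<close> commutes with \<open>M\<close>, a solvable ideal
    \<open>I\<close> of \<open>S\<close> gives an ideal \<open>I + W\<close> of \<open>L\<close>;
    hence \<open>I\<close> lies in \<open>C \<inter> S\<close>.\<close>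
  have semi: "semisimple_subalg scale br S"
    unfolding semisimple_subalg_def
  proof (intro conjI allI impI subS)
    fix I assume I: "subspace I \<and> I \<subseteq> S \<and> (\<forall>s\<in>S. \<forall>i\<in>I. br s i \<in> I) \<and> solvable_set scale br I"
    have "ideal (ssum I W)"
    proof (rule idealI)
      fix x y assume "y \<in> ssum I W"
      then obtain i v where y: "y = i + v" "i \<in> I" "v \<in> W" by blast
      obtain w c s where x: "x = w + c + s" "w \<in> W" "c \<in> C" "s \<in> S" using decomp by blast
      have "i \<in> M" using y(2) I S(3) by auto
      then have "br c i = 0" using cM x(3) by simp
      then have "br x y = br s i + (br w i + br x v)" unfolding x(1) y(1) by (simp add: br_add_left br_add_right)
      moreover have "br w i + br x v \<in> W"
        using x y ideal_left[OF W'(1)] ideal_right[OF W'(1)] by (intro subspace_add W'(3))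
      ultimately show "br x y \<in> ssum I W" using I x y by blast
    qed (simp add: I subspace_sums W'(3))
    moreover obtain n where n: "derived scale br n I = {0}" using I unfolding solvable_set_def by blast
    moreover have "derived scale br n I \<subseteq> W" using n subspace_0[OF W'(3)] by simp
    ultimately have "i \<in> C" if "i \<in> I" for i
      using solv_M[of I n i] that I S(3) by auto
    then have "I \<subseteq> C" by blast
    then have "I \<subseteq> {0}" using S(4) I by auto
    then show "I = {0}" using I subspace_0[of I] by auto
  qed
  have "x = 0" if x: "x \<in> ssum W C" "x \<in> S" for x
  proof -
    obtain w c where wc: "x = w + c" "w \<in> W" "c \<in> C" using x by blast
    \<comment> \<open>\<open>x - c\<close> is the component \<open>w\<close> in \<open>W\<close>, so
      it lies in \<open>W \<inter> M\<close> and vanishes.\<close>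
    have "x - c \<in> M" using x wc S(3) CM by (intro subspace_diff sM') auto
    then have "w = 0" using wc WM(2) by auto
    then show ?thesis using wc x S(4) by auto
  qed
  then have "radical scale br \<inter> S = {0}"
    unfolding rad using subspace_0[OF S(1)] subspace_0[OF W'(3)] subspace_0[OF sC] by force
  moreover have "{r + s |r s. r \<in> radical scale br \<and> s \<in> S} = UNIV"
    unfolding rad using decomp by blast
  ultimately have levi: "levi_subalgebra scale br S" unfolding levi_subalgebra_def using semi by blast
  have "acts_semisimply scale (br c) W" if "c \<in> C" for c
  proof (rule acts_semisimply_if_commutes[OF W])
    fix x w assume "w \<in> W"
    moreover have "br c x \<in> centraliser br W" using that unfolding WM(3) C_def by blast
    ultimately show "br c (br x w) = br x (br c w)" by (rule commute_on_if_bracket_centralises[rotated])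
  qed
  moreover have "abelian br C" unfolding abelian_def using cM CM by blast
  moreover have "\<forall>c\<in>C. \<forall>s\<in>S. br c s = 0" using cM S(3) by blast
  moreover have "{w + c + s | w c s. w \<in> W \<and> c \<in> C \<and> s \<in> S} = UNIV" using decomp by blast
  ultimately show ?R using mon abW subC levi S(4,5) WM(2) by blast
next
  assume ?R
  then obtain W C S where mon: "monolith scale br W" "abelian br W"
    and C: "subalgebra C" "abelian br C" and levi: "levi_subalgebra scale br S"
    and CS: "\<forall>c\<in>C. \<forall>s\<in>S. br c s = 0" and int: "W \<inter> ssum C S = {0}"
    and all: "{w + c + s | w c s. w \<in> W \<and> c \<in> C \<and> s \<in> S} = UNIV" by blast
  have S: "subalgebra S" using levi unfolding levi_subalgebra_def semisimple_subalg_def by blast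
  have W: "minimal_ideal scale br W" using mon unfolding monolith_def by blast
  \<comment> \<open>For the converse, \<open>C + S\<close> is a subalgebra complementing
    \<open>W\<close>, hence maximal; it is core-free because a nonzero ideal in it would contain
    \<open>W\<close>.\<close>
  have M: "subalgebra (ssum C S)"
  proof (rule subalgebraI)
    fix x y assume "x \<in> ssum C S" "y \<in> ssum C S"
    then obtain c s d t where *: "x = c + s" "y = d + t" "c \<in> C" "d \<in> C" "s \<in> S" "t \<in> S" by blast
    have "br s d = 0" using CS * br_anti[of s d] by simp
    then have "br x y = br s t" using * CS C(2) unfolding abelian_def by (simp add: br_add_left br_add_right)
    then have "br x y \<in> S" using subalgebra_br[OF S *(5,6)] by simp
    then show "br x y \<in> ssum C S"
      using ssum_right[OF subalgebra_subspace[OF C(1)], of S] by auto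
  qed (simp add: subspace_sums C S subalgebra_subspace)
  have "x \<in> ssum W (ssum C S)" for x
  proof -
    obtain w c s where *: "x = w + c + s" "w \<in> W" "c \<in> C" "s \<in> S" using all by blast
    then have "x = w + (c + s)" by (simp only: add.assoc)
    then show ?thesis using * by blast
  qed
  then have "maximal_subalgebra scale br (ssum C S)"
    using complement_maximal_subalgebra[OF W mon(2) M _ int] by blast
  then show "primitive_type1 scale br"
    using core_free_if_complements_monolith[OF mon(1) int] mon unfolding primitive_type1_def primitive_def by blast
qed

subsection \<open>Solvable primitive algebras\<close>

text \<open>\<open>[A, A]\<close> is zero or \<open>A\<close>; if it were \<open>A\<close>, then
  \<open>A\<close> would lie in every term of the derived series of \<open>L\<close>.\<close>

lemma minimal_ideal_abelian_if_solvable: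
  assumes "solvable_lie scale br" and A: "minimal_ideal scale br A"
  shows "abelian br A"
proof -
  note A' = minimal_idealD[OF A]
  have "brackets A A \<subseteq> A" by (intro brackets_least A'(3) ideal_left[OF A'(1)])
  then consider "brackets A A = {0}" | "brackets A A = A"
    using A'(4)[OF ideal_brackets[OF A'(1) A'(1)]] by blast
  then show ?thesis
  proof cases
    case 1
    then show ?thesis unfolding abelian_def using br_in_brackets[of _ A _ A] by auto
  next
    case 2
    have "A \<subseteq> derived scale br n UNIV" for n
    proof (induction n)
      case (Suc n)
      have "brackets A A \<subseteq> derived scale br (Suc n) UNIV"
        unfolding derived.simps using Suc by (intro span_mono) blast
      then show ?case using 2 by simp
    qed simp
    moreover have "\<exists>n. derived scale br n UNIV = {0}"
      using assms(1) unfolding solvable_lie_def solvable_set_def .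
    ultimately have "A \<subseteq> {0}" by metis
    then show ?thesis using A'(2) subspace_0[OF A'(3)] by blast
  qed
qed

text \<open>An element \<open>b\<close> of an ideal that is abelian modulo \<open>A\<close>, acting bijectively on \<open>A\<close>, has
  Fitting null component \<open>ker (ad b)\<^sup>2\<close>, which is then a complement of \<open>A\<close>.\<close>

lemma exists_complement_of_self_centralising:
  assumes sol: "solvable_lie scale br" and A: "minimal_ideal scale br A" and cent: "centraliser br A = A"
  obtains M where "subalgebra M" "ssum A M = UNIV" "A \<inter> M = {0}"
proof -
  note A' = minimal_idealD[OF A]
  have "\<exists>n. derived scale br n UNIV \<subseteq> A"
    using sol subspace_0[OF A'(3)] unfolding solvable_lie_def solvable_set_def
    by (metis empty_subsetI insert_subset)
  \<comment> \<open>With \<open>n\<close> least, the term before it is the last one outside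
    \<open>A\<close>; it is abelian modulo \<open>A\<close> and does not centralise
    \<open>A\<close>. If \<open>n = 0\<close>, then \<open>A\<close> is all of \<open>L\<close> and
    zero is a complement.\<close>
  then obtain n where n: "derived scale br n UNIV \<subseteq> A" "\<And>m. m < n \<Longrightarrow> \<not> derived scale br m UNIV \<subseteq> A"
    using exists_least_iff[of "\<lambda>n. derived scale br n UNIV \<subseteq> A"] by blast
  show thesis
  proof (cases n)
    case 0
    then have "A = UNIV" using n(1) by auto
    then show thesis using that[of "{0}"] by (auto simp: lie_subalgebra_def)
  next
    case (Suc m)
    define B where "B = derived scale br m UNIV"
    have B: "ideal B" unfolding B_def by (rule ideal_derived[OF ideal_UNIV])
    have BA: "br b c \<in> A" if "b \<in> B" "c \<in> B" for b c
      using br_in_brackets[OF that] n(1) Suc unfolding B_def by auto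
    have "\<not> B \<subseteq> centraliser br A" using n(2) Suc unfolding B_def cent by simp
    moreover have "br b (br c w) = br c (br b w)" if "b \<in> B" "c \<in> B" "w \<in> A" for b c w
      using commute_on_if_bracket_centralises[OF _ that(3)] BA[OF that(1,2)] cent by simp
    ultimately obtain b where b: "b \<in> B" and inj: "\<And>w. w \<in> A \<Longrightarrow> br b w = 0 \<Longrightarrow> w = 0"
      using exists_injective[OF A B] by blast
    have brA: "br x a \<in> A" if "a \<in> A" for x a using ideal_left[OF A'(1) that] .
    have "br b ` A \<subseteq> A" using brA by blast
    then obtain g where g: "range g \<subseteq> A" "\<And>w. w \<in> A \<Longrightarrow> br b (g w) = w"
      using linear_inverse_on[OF linear_br[of b] A'(3) _ inj] by metis
    \<comment> \<open>One bracket with \<open>b\<close> lands in the ideal \<open>B\<close>, the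
      second in \<open>[B, B]\<close>, hence in \<open>A\<close>.\<close>
    have sq: "br b (br b x) \<in> A" for x by (rule BA[OF b ideal_right[OF B b]])
    let ?M = "{x. br b (br b x) = 0}"
    have "subalgebra ?M"
    proof (rule subalgebraI)
      show "subspace ?M" unfolding subspace_def by (simp add: br_add_right br_scale_right)
      fix x y assume "x \<in> ?M" "y \<in> ?M"
      then have "br b (br b (br b (br x y))) = 0"
        by (simp add: br_leibniz[of b x y] br_leibniz[of b "br b x" y] br_leibniz[of b x "br b y"]
            br_leibniz[of b "br b x" "br b y"] br_add_right)
      then show "br x y \<in> ?M" using inj[OF sq] by blast
    qed
    moreover have "x \<in> ssum A ?M" for x
    proof -
      \<comment> \<open>The element of \<open>A\<close> with the same image as \<open>x\<close>
        under \<open>(ad b)\<^sup>2\<close>.\<close>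
      let ?a = "g (g (br b (br b x)))"
      have "?a \<in> A" using g(1) by blast
      moreover have "br b (br b ?a) = br b (br b x)" using g sq by (simp add: range_subsetD)
      then have "x - ?a \<in> ?M" by (simp add: br_diff_right)
      moreover have "x = ?a + (x - ?a)" by simp
      ultimately show ?thesis by blast
    qed
    moreover have "A \<inter> ?M = {0}" using inj brA subspace_0[OF A'(3)] by auto
    ultimately show thesis using that[of ?M] by blast
  qed
qed

theorem solvable_primitive_iff:
  assumes sol: "solvable_lie scale br"
  shows "primitive scale br \<longleftrightarrow> (\<exists>A. minimal_ideal scale br A \<and> centraliser br A = A)"
proof
  assume "primitive scale br"
  then obtain M where M: "maximal_subalgebra scale br M" "core_free scale br M"
    unfolding primitive_def by blast
  then have "0 \<in> M" "M \<noteq> UNIV"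
    using subalgebra_subspace[of M] subspace_0[of M] unfolding maximal_subalgebra_def by simp_all
  \<comment> \<open>The zero algebra has no minimal ideal; a proper subalgebra \<open>M\<close>
    rules it out.\<close>
  then have "(UNIV :: 'v set) \<noteq> {0}" by (metis UNIV_I singletonD subsetI top.extremum_uniqueI)
  then obtain A where A: "minimal_ideal scale br A" using exists_minimal_ideal[OF ideal_UNIV] by blast
  then show "\<exists>A. minimal_ideal scale br A \<and> centraliser br A = A"
    using core_free_maximal_subalgebra_complement(3)[OF A minimal_ideal_abelian_if_solvable[OF sol A] M] by blast
next
  assume "\<exists>A. minimal_ideal scale br A \<and> centraliser br A = A"
  then obtain A where A: "minimal_ideal scale br A" "centraliser br A = A" by blast
  obtain M where M: "subalgebra M" "ssum A M = UNIV" "A \<inter> M = {0}"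
    using exists_complement_of_self_centralising[OF sol A] .
  then show "primitive scale br"
    using complement_maximal_subalgebra[OF A(1) minimal_ideal_abelian_if_solvable[OF sol A(1)] M]
      core_free_if_self_centralising[OF minimal_idealD(1)[OF A(1)] A(2) M(3)]
    unfolding primitive_def by blast
qed

end

section \<open>From the predicates \<open>lie_algebra\<close> and \<open>fin_dim\<close> to the
  locale\<close>

lemma fd_lie_algebra_exists_basis:
  assumes "lie_algebra scale br" "fin_dim scale"
  obtains B where "fd_lie_algebra scale B br"
proof -
  interpret vector_space scale using assms(1) unfolding lie_algebra_def by blast
  obtain G where G: "finite G" "span G = UNIV" using assms(2) unfolding fin_dim_def by blast
  obtain B where B: "B \<subseteq> G" "independent B" "G \<subseteq> span B" by (rule maximal_independent_subset)
  have "span B = UNIV" using G(2) span_minimal[OF B(3)] by auto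
  then have "fd_lie_algebra scale B br"
    using B assms(1) finite_subset[OF B(1) G(1)] by unfold_locales auto
  then show thesis by (rule that)
qed

theorem theorem1p5:
  fixes scale :: "'k::field \<Rightarrow> 'v::ab_group_add \<Rightarrow> 'v"
    and br :: "'v \<Rightarrow> 'v \<Rightarrow> 'v"
  assumes "lie_algebra scale br" and "fin_dim scale"
  shows "((primitive_type1 scale br \<longleftrightarrow>
            (\<exists>W. monolith scale br W \<and> abelian br W) \<and> frattini scale br = {0})) \<and>
         (CHAR('k) = 0 \<longrightarrow>
           (primitive_type1 scale br \<longleftrightarrow>
             (\<exists>W C S. monolith scale br W \<and> abelian br W \<and>
                lie_subalgebra scale br C \<and> abelian br C \<and>
                (\<forall>c\<in>C. acts_semisimply scale (br c) W) \<and>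
                levi_subalgebra scale br S \<and>
                (\<forall>c\<in>C. \<forall>s\<in>S. br c s = 0) \<and>
                C \<inter> S = {0} \<and>
                W \<inter> {c + s | c s. c \<in> C \<and> s \<in> S} = {0} \<and>
                {w + c + s | w c s. w \<in> W \<and> c \<in> C \<and> s \<in> S} = UNIV))) \<and>
         (solvable_lie scale br \<longrightarrow>
           (primitive scale br \<longleftrightarrow>
             (\<exists>A. minimal_ideal scale br A \<and> centraliser br A = A)))"
proof -
  obtain B where "fd_lie_algebra scale B br" using fd_lie_algebra_exists_basis[OF assms] .
  then interpret fd_lie_algebra scale B br .
  show ?thesis
    using primitive_type1_iff_frattini primitive_type1_iff_decomposition solvable_primitive_iff by blast
qed

end
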